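(* Let $J\in\mathbb{C}^{n\times n}$ be nonsingular. Then $$\operatorname{sol}(J)\oplus\operatorname{cosol}(J)=\operatorname{cent}(\operatorname{cosq}(J)).$$ For the conjugate transpose, $$\operatorname{sol}^H(J)\oplus\operatorname{cosol}^H(J)=\operatorname{cent}(\operatorname{cosq}^H(J)).$$
   Context: For a matrix $A$, $A^T$ is the transpose and $A^H$ the conjugate transpose; $A^{-T}=(A^T)^{-1}$, $A^{-H}=(A^H)^{-1}$. $\operatorname{cent}(A)$ is the set of all $n\times n$ complex matrices commuting with $A$. $\operatorname{cosq}(J)=J^{-T}J$ and $\operatorname{cosq}^H(J)=J^{-H}J$. For a square complex matrix $J$ define the sets of $n\times n$ complex matrices $\operatorname{sol}(J)=\{X: X^TJ+JX=0\}$, $\operatorname{cosol}(J)=\{X:X^TJ-JX=0\}$, $\operatorname{sol}^H(J)=\{X:X^HJ+JX=0\}$, $\operatorname{cosol}^H(J)=\{X:X^HJ-JX=0\}$. The first two are complex vector spaces; the last two are real (in general not complex) vector spaces, and the second direct sum is one of real vector spaces. *)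

theory Defs
  imports "HOL-Analysis.Analysis"
begin

text \<open>
  The library provides multiplication of complex matrices by real scalars only;
  the following is multiplication by complex scalars.
\<close>

definition cmat_scale :: "complex \<Rightarrow> complex^'n^'m \<Rightarrow> complex^'n^'m" where
  "cmat_scale c A = (\<chi> i j. c * A $ i $ j)"

lemma vector_space_cmat_scale:
  "vector_space (cmat_scale :: complex \<Rightarrow> complex^'n^'m \<Rightarrow> complex^'n^'m)"
  by unfold_locales (simp_all add: cmat_scale_def vec_eq_iff algebra_simps)

text \<open>
  \<open>W\<close> is the internal direct sum of the linear subspaces \<open>U\<close> and \<open>V\<close>, where linearity
  refers to the scalar multiplication \<open>smul\<close>.
\<close>

definition direct_sum_of ::
  "('k::field \<Rightarrow> 'v::ab_group_add \<Rightarrow> 'v) \<Rightarrow> 'v set \<Rightarrow> 'v set \<Rightarrow> 'v set \<Rightarrow> bool" where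
  "direct_sum_of smul U V W \<longleftrightarrow>
     module.subspace smul U \<and> module.subspace smul V \<and> module.subspace smul W \<and>
     {x + y |x y. x \<in> U \<and> y \<in> V} = W \<and> U \<inter> V = {0}"

definition ctranspose :: "complex^'n^'m \<Rightarrow> complex^'m^'n" where
  "ctranspose A = (\<chi> i j. cnj (A $ j $ i))"

definition cent :: "complex^'n^'n \<Rightarrow> (complex^'n^'n) set" where
  "cent A = {X. X ** A = A ** X}"

text \<open>
  The inverse \<^const>\<open>matrix_inv\<close> is meaningful only for invertible matrices, so the two
  cosquares are to be used for nonsingular \<open>J\<close>.
\<close>

definition cosq :: "complex^'n^'n \<Rightarrow> complex^'n^'n" where
  "cosq J = matrix_inv (transpose J) ** J"

definition cosqH :: "complex^'n^'n \<Rightarrow> complex^'n^'n" where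
  "cosqH J = matrix_inv (ctranspose J) ** J"

definition sol :: "complex^'n^'n \<Rightarrow> (complex^'n^'n) set" where
  "sol J = {X. transpose X ** J + J ** X = 0}"

definition cosol :: "complex^'n^'n \<Rightarrow> (complex^'n^'n) set" where
  "cosol J = {X. transpose X ** J - J ** X = 0}"

definition solH :: "complex^'n^'n \<Rightarrow> (complex^'n^'n) set" where
  "solH J = {X. ctranspose X ** J + J ** X = 0}"

definition cosolH :: "complex^'n^'n \<Rightarrow> (complex^'n^'n) set" where
  "cosolH J = {X. ctranspose X ** J - J ** X = 0}"

end

theory Submission
  imports Defs
begin

text \<open>
  Let \<open>*\<close> be the transpose or the conjugate transpose and put \<open>f X = J\<^sup>-\<^sup>1 X\<^sup>* J\<close>.
  Multiplying the defining equations by \<open>J\<^sup>-\<^sup>1\<close> shows that the two solution spaces are the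
  eigenspaces of \<open>f\<close> for the eigenvalues \<open>-1\<close> and \<open>1\<close>. Since \<open>*\<close> is an involution that
  reverses products,
  \<open>f (f X) = J\<^sup>-\<^sup>1 J\<^sup>* X (J\<^sup>*)\<^sup>-\<^sup>1 J = C\<^sup>-\<^sup>1 X C\<close> with \<open>C = (J\<^sup>*)\<^sup>-\<^sup>1 J\<close>,
  so the fixed points of \<open>f \<circ> f\<close> are exactly the matrices commuting with the cosquare \<open>C\<close>
  (\<open>twisted_involution_direct_sum\<close>). The claim is therefore the fact that the fixed space of the
  square of a linear map splits into its eigenspaces for \<open>\<plusminus>1\<close>, by
  \<open>X = (X - f X) / 2 + (X + f X) / 2\<close> (\<open>eigenspaces_direct_sum_of_square_fixed\<close>). The map \<open>f\<close> is
  complex linear for the transpose, but only real linear for the conjugate transpose, which is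
  why the scalars are kept abstract.
\<close>

lemma eigenspaces_direct_sum_of_square_fixed:
  fixes smul :: "'k::field \<Rightarrow> 'v::ab_group_add \<Rightarrow> 'v"
  assumes lin: "Vector_Spaces.linear smul smul f" and two: "(2::'k) \<noteq> 0"
  shows "direct_sum_of smul {x. f x = - x} {x. f x = x} {x. f (f x) = x}"
proof -
  interpret f: Vector_Spaces.linear smul smul f by (fact lin)
  have halves: "smul (1 / 2) x + smul (1 / 2) x = x" for x
    using two by (simp flip: f.vs1.scale_left_distrib)
  have "{x + y |x y. x \<in> {x. f x = - x} \<and> y \<in> {x. f x = x}} = {x. f (f x) = x}" (is "?S = ?W")
  proof (intro equalityI subsetI)
    fix x assume "x \<in> ?S"
    then show "x \<in> ?W" by (auto simp: f.add f.diff)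
  next
    fix x assume "x \<in> ?W"
    then have fixed: "f (f x) = x" by simp
    let ?y = "smul (1 / 2) (x - f x)" and ?z = "smul (1 / 2) (x + f x)"
    have "f ?y = - ?y"
      by (simp add: f.scale f.diff fixed flip: f.vs1.scale_minus_right)
    moreover have "f ?z = ?z"
      by (simp add: f.scale f.add fixed add.commute)
    moreover have "x = ?y + ?z"
      using halves[of x] by (simp add: f.vs1.scale_right_distrib f.vs1.scale_right_diff_distrib)
    ultimately show "x \<in> ?S" by blast
  qed
  moreover have "{x. f x = - x} \<inter> {x. f x = x} = {0}"
  proof -
    have "x = 0" if "f x = - x" "f x = x" for x
    proof -
      have "x = - x" using that by simp
      then have "smul (1 / 2) x = smul (1 / 2) (- x)" by (rule arg_cong)
      then show ?thesis using halves[of x] by (metis add.left_inverse f.vs1.scale_minus_right)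
    qed
    then show ?thesis by auto
  qed
  ultimately show ?thesis
    unfolding direct_sum_of_def f.vs1.subspace_def
    by (auto simp: f.add f.scale)
qed

lemma matrix_inv_eqI:
  fixes A :: "'a::semiring_1^'n^'m"
  assumes "A ** B = mat 1" and "B ** A = mat 1"
  shows "matrix_inv A = B"
  unfolding matrix_inv_def
proof (rule some_equality)
  fix B' assume "A ** B' = mat 1 \<and> B' ** A = mat 1"
  then show "B' = B"
    using assms by (metis matrix_mul_assoc matrix_mul_lid matrix_mul_rid)
qed (use assms in blast)

lemma matrix_mult_add_rdistrib:
  fixes A B :: "'a::semiring_1^'n^'m"
  shows "(A + B) ** C = A ** C + B ** C"
  by (simp add: matrix_matrix_mult_def vec_eq_iff sum.distrib distrib_right)

text \<open>
  The properties of \<open>star\<close> and \<open>smul\<close> assumed here are those shared by the transpose with complex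
  scalars and the conjugate transpose with real ones.
\<close>

lemma twisted_involution_direct_sum:
  fixes J :: "complex^'n^'n"
    and smul :: "'k::field \<Rightarrow> complex^'n^'n \<Rightarrow> complex^'n^'n"
  assumes J: "invertible J"
    and star_mult: "\<And>A B. star (A ** B) = star B ** star A"
    and star_star: "\<And>A. star (star A) = A"
    and star_lin: "Vector_Spaces.linear smul smul star"
    and smul_left: "\<And>c A B. smul c A ** B = smul c (A ** B)"
    and smul_right: "\<And>c A B. A ** smul c B = smul c (A ** B)"
    and two: "(2::'k) \<noteq> 0"
  shows "direct_sum_of smul {X. star X ** J + J ** X = 0} {X. star X ** J - J ** X = 0}
           (cent (matrix_inv (star J) ** J))"
proof -
  interpret star: Vector_Spaces.linear smul smul star by (fact star_lin)
  obtain K where JK: "J ** K = mat 1" and KJ: "K ** J = mat 1"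
    using J unfolding invertible_def by blast
  have star_one: "star (mat 1) = mat 1"
    by (metis matrix_mul_lid star_mult star_star)
  have KJs: "star K ** star J = mat 1" and JKs: "star J ** star K = mat 1"
    by (simp_all flip: star_mult add: JK KJ star_one)
  have inv_star: "matrix_inv (star J) = star K"
    using JKs KJs by (rule matrix_inv_eqI)
  define f where "f X = K ** star X ** J" for X
  have shift: "f X = Y \<longleftrightarrow> star X ** J = J ** Y" for X Y
  proof
    assume "f X = Y"
    then have "J ** Y = (J ** K) ** (star X ** J)" by (auto simp: f_def matrix_mul_assoc)
    then show "star X ** J = J ** Y" by (simp add: JK)
  next
    assume "star X ** J = J ** Y"
    then have "f X = (K ** J) ** Y" by (simp add: f_def flip: matrix_mul_assoc)
    then show "f X = Y" by (simp add: KJ)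
  qed
  have neg: "J ** (- X) = - (J ** X)" for X
    by (simp add: matrix_matrix_mult_def vec_eq_iff sum_negf)
  have square: "f (f X) = K ** star J ** X ** star K ** J" for X
    by (simp add: f_def star_mult star_star matrix_mul_assoc)
  have fixed: "f (f X) = X \<longleftrightarrow> X \<in> cent (matrix_inv (star J) ** J)" for X
  proof -
    have "f (f X) = X \<longleftrightarrow> X ** (star K ** J) = star K ** J ** X"
    proof
      assume "f (f X) = X"
      then have "star K ** J ** X = star K ** (J ** K) ** star J ** X ** star K ** J"
        unfolding square by (metis matrix_mul_assoc)
      also have "\<dots> = X ** (star K ** J)"
        by (simp add: JK KJs) (simp flip: matrix_mul_assoc)
      finally show "X ** (star K ** J) = star K ** J ** X" by simp
    next
      assume "X ** (star K ** J) = star K ** J ** X"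
      then have "f (f X) = K ** (star J ** star K) ** J ** X"
        unfolding square by (metis matrix_mul_assoc)
      then show "f (f X) = X" by (simp add: JKs KJ)
    qed
    then show ?thesis by (simp add: cent_def inv_star)
  qed
  have "Vector_Spaces.linear smul smul f"
    by unfold_locales
      (simp_all add: f_def star.add star.scale matrix_add_ldistrib matrix_mult_add_rdistrib
        smul_left smul_right)
  then have "direct_sum_of smul {X. f X = - X} {X. f X = X} {X. f (f X) = X}"
    using two by (rule eigenspaces_direct_sum_of_square_fixed)
  moreover have "{X. star X ** J + J ** X = 0} = {X. f X = - X}"
    unfolding shift neg by (simp add: eq_neg_iff_add_eq_0)
  moreover have "{X. star X ** J - J ** X = 0} = {X. f X = X}"
    unfolding shift by simp
  ultimately show ?thesis unfolding fixed by simp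
qed

lemma ctranspose_mult: "ctranspose (A ** B) = ctranspose B ** ctranspose A"
  by (simp add: ctranspose_def matrix_matrix_mult_def vec_eq_iff mult.commute)

lemma ctranspose_ctranspose: "ctranspose (ctranspose A) = A"
  by (simp add: ctranspose_def vec_eq_iff)

lemma linear_transpose:
  "Vector_Spaces.linear cmat_scale cmat_scale (transpose :: complex^'n^'m \<Rightarrow> complex^'m^'n)"
proof -
  interpret a: vector_space "cmat_scale :: complex \<Rightarrow> complex^'n^'m \<Rightarrow> complex^'n^'m"
    by (rule vector_space_cmat_scale)
  interpret b: vector_space "cmat_scale :: complex \<Rightarrow> complex^'m^'n \<Rightarrow> complex^'m^'n"
    by (rule vector_space_cmat_scale)
  show ?thesis
    by unfold_locales (simp_all add: transpose_def cmat_scale_def vec_eq_iff)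
qed

lemma linear_ctranspose: "Vector_Spaces.linear (*\<^sub>R) (*\<^sub>R) ctranspose"
  by unfold_locales (simp_all add: ctranspose_def vec_eq_iff algebra_simps)

lemma cmat_scale_mult_left: "cmat_scale c A ** B = cmat_scale c (A ** B)"
  and cmat_scale_mult_right: "A ** cmat_scale c B = cmat_scale c (A ** B)"
  by (simp_all add: cmat_scale_def matrix_matrix_mult_def vec_eq_iff sum_distrib_left ac_simps)

lemma scaleR_mult_left: "(r *\<^sub>R A) ** B = r *\<^sub>R (A ** (B :: complex^'n^'m))"
  and scaleR_mult_right: "A ** (r *\<^sub>R B) = r *\<^sub>R (A ** (B :: complex^'n^'m))"
  by (simp_all add: matrix_matrix_mult_def vec_eq_iff scaleR_sum_right)

theorem corollary2p6p1:
  fixes J :: "complex^'n^'n"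
  assumes "invertible J"
  shows "direct_sum_of cmat_scale (sol J) (cosol J) (cent (cosq J)) \<and>
         direct_sum_of (scaleR :: real \<Rightarrow> complex^'n^'n \<Rightarrow> complex^'n^'n)
           (solH J) (cosolH J) (cent (cosqH J))"
  unfolding sol_def cosol_def cosq_def solH_def cosolH_def cosqH_def
  using twisted_involution_direct_sum[OF assms matrix_transpose_mul transpose_transpose
      linear_transpose cmat_scale_mult_left cmat_scale_mult_right]
    twisted_involution_direct_sum[OF assms ctranspose_mult ctranspose_ctranspose
      linear_ctranspose scaleR_mult_left scaleR_mult_right]
  by simp

end
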